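(* Assume that $1<p<\infty$ and that $X$ is a proper connected metric space equipped with a locally doubling measure $\mu$ supporting a local $p$-Poincaré inequality. Assume that $X$ is $p$-parabolic and that $\mu(X)=\infty$. Then $$\mathrm{cap}_p(E,X)=0\quad\text{for every set }E\subset X.$$ Moreover, if $C_p(E)>0$ then there is no admissible function $u$ for $\mathrm{cap}_p(E,X)$ with $\int_X g_u^p\,d\mu=0$, i.e. the infimum $\inf_u\int_X g_u^p\,d\mu$ over admissible functions is not attained for $\mathrm{cap}_p(E,X)$.
   Context: $X=(X,d,\mu)$ is a metric space equipped with a positive complete Borel measure $\mu$ with $0<\mu(B)<\infty$ for every ball $B$. Balls are open and come with a fixed centre and radius; $\lambda B(x,r):=B(x,\lambda r)$. $\overline{\mathbf{R}}=[-\infty,\infty]$ and $\chi_A$ is the characteristic function of $A$. Upper gradients. A curve is a nonconstant compact rectifiable curve, parameterized by arc length $ds$. A property holds for $p$-almost every curve if there is a nonnegative $\rho\in L^p(X)$ with $\int_\gamma\rho\,ds=\infty$ for every curve $\gamma$ for which it fails. A measurable $g:X\to[0,\infty]$ is a $p$-weak upper gradient of $f:X\to\overline{\mathbf{R}}$ if for $p$-almost all curves $\gamma:[0,l_\gamma]\to X$, $|f(\gamma(0))-f(\gamma(l_\gamma))|\le\int_\gamma g\,ds$, where the left-hand side is $\infty$ if at least one of the terms is infinite. If $f$ has a $p$-weak upper gradient in $L^p_{\rm loc}(X)$, then $g_f$ denotes its minimal $p$-weak upper gradient ($g_f\le g$ a.e. for every $p$-weak upper gradient $g\in L^p_{\rm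 loc}(X)$ of $f$). $N^{1,p}(X)$ is the space of measurable $f$, defined everywhere with values in $\overline{\mathbf{R}}$, with $\|f\|_{N^{1,p}(X)}^p=\int_X|f|^p\,d\mu+\inf_g\int_X g^p\,d\mu<\infty$, infimum over all $p$-weak upper gradients $g$ of $f$. For measurable $E\subset X$ these notions are defined by regarding $(E,d|_E,\mu|_E)$ as a metric space. The Sobolev capacity is $C_p(E)=\inf\|f\|_{N^{1,p}(X)}^p$ over $f\in N^{1,p}(X)$ with $f\ge1$ on $E$. Doubling and Poincaré. $\mu$ is doubling within an open set $U$ if there is $C>0$ with $\mu(2B)\le C\mu(B)$ for all balls $B\subset U$. The $p$-Poincaré inequality holds within $U$ if there are $C>0$, $\lambda\ge1$ such that for all balls $B\subset U$ with radius $r_B$, all integrable $u$ on $\lambda B$ and all $p$-weak upper gradients $g$ of $u$ in $\lambda B$, $\frac1{\mu(B)}\int_B|u-u_B|\,d\mu\le Cr_B\bigl(\frac1{\mu(\lambda B)}\int_{\lambda B}g^p\,d\mu\bigr)^{1/p}$, where $u_B=\frac1{\mu(B)}\int_B u\,d\mu$. Each property is local if for every $x\in X$ there is $r>0$ such that it holds within $B(x,r)$. $X$ is proper if all closed bounded sets are compact. Condenser capacity. A function $u$ is admissible for $\mathrm{cap}_p(E,\Omega)$ if $u\in N^{1,p}(X)$ and $\chi_E\le u\le\chi_\Omega$. For open $\Omega$ and bounded $E\subset\Omega$, $\mathrm{cap}_p(E,\Omega)=\inf_u\int_\Omega g_u^p\,d\mu$ over admissible $u$ ($=\infty$ if there is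 no such $u$); for unbounded $E\subset\Omega$, $\mathrm{cap}_p(E,\Omega)=\lim_{j\to\infty}\mathrm{cap}_p(E\cap B(x_0,j),\Omega)$, where $x_0\in X$ is any fixed point (the limit does not depend on it). An unbounded $X$ is $p$-parabolic if $\mathrm{cap}_p(K,X)=0$ for all compact $K\subset X$. *)

theory Defs
  imports "HOL-Analysis.Analysis"
begin

text \<open>
  A metric measure space is a measure \<open>M\<close> on a metric type; its underlying set is \<open>space M\<close>.
  The ambient space \<open>X\<close> has \<open>space M = UNIV\<close>, and a measurable subset \<open>E\<close> of it, regarded as
  a metric measure space, is \<open>restrict_space M E\<close>.
\<close>

definition metric_measure_space :: "'a::metric_space measure \<Rightarrow> bool" where
  "metric_measure_space M \<longleftrightarrow>
     space M = UNIV \<and> sets borel \<subseteq> sets M \<and> complete_measure M \<and>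
     (\<forall>x r. 0 < r \<longrightarrow> 0 < emeasure M (ball x r) \<and> emeasure M (ball x r) < \<infinity>)"

definition proper_space :: "'a::metric_space itself \<Rightarrow> bool" where
  "proper_space _ \<longleftrightarrow> (\<forall>S :: 'a set. closed S \<and> bounded S \<longrightarrow> compact S)"

definition epowr :: "ennreal \<Rightarrow> real \<Rightarrow> ennreal" where
  "epowr a q = (if a = \<infinity> then \<infinity> else ennreal (enn2real a powr q))"


subsection \<open>Curves and line integrals\<close>

definition curve_length :: "(real \<Rightarrow> 'a::metric_space) \<Rightarrow> real \<Rightarrow> real \<Rightarrow> ennreal" where
  "curve_length \<gamma> a b =
     (SUP (n, t) \<in> {(n :: nat, t :: nat \<Rightarrow> real). t 0 = a \<and> t n = b \<and> (\<forall>i<n. t i \<le> t (Suc i))}.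
        \<Sum>i<n. ennreal (dist (\<gamma> (t i)) (\<gamma> (t (Suc i)))))"

text \<open>
  A nonconstant compact rectifiable curve in \<open>A\<close>, parameterized by arc length: a map on
  \<open>[0, l]\<close> with \<open>0 < l < \<infinity>\<close>, where \<open>l\<close> is the length. Values of \<open>\<gamma>\<close> outside \<open>[0, l]\<close> play no role.
\<close>

definition arc_length_curve :: "'a::metric_space set \<Rightarrow> (real \<Rightarrow> 'a) \<Rightarrow> real \<Rightarrow> bool" where
  "arc_length_curve A \<gamma> l \<longleftrightarrow>
     0 < l \<and> continuous_on {0..l} \<gamma> \<and> \<gamma> ` {0..l} \<subseteq> A \<and>
     (\<forall>s t. 0 \<le> s \<and> s \<le> t \<and> t \<le> l \<longrightarrow> curve_length \<gamma> s t = ennreal (t - s))"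

text \<open>
  For functions \<open>\<rho>\<close> that are merely measurable on \<open>X\<close>, the composition \<open>\<rho> \<circ> \<gamma>\<close> may fail to be
  Lebesgue measurable on an exceptional family of curves; there \<open>nn_integral\<close> is the lower integral.
  When \<open>M\<close> is the completion of a Borel measure this does not affect the notions below: \<open>\<rho>\<close> agrees
  almost everywhere with some Borel function \<open>\<ge> \<rho>\<close>, hence almost everywhere along \<open>p\<close>-almost
  every curve.
\<close>

definition curve_integral :: "('a \<Rightarrow> ennreal) \<Rightarrow> (real \<Rightarrow> 'a) \<Rightarrow> real \<Rightarrow> ennreal" where
  "curve_integral \<rho> \<gamma> l = (\<integral>\<^sup>+ t \<in> {0..l}. \<rho> (\<gamma> t) \<partial>lborel)"


subsection \<open>Weak upper gradients and Newtonian spaces\<close>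

definition Lp_nonneg :: "'a measure \<Rightarrow> real \<Rightarrow> ('a \<Rightarrow> ennreal) set" where
  "Lp_nonneg M p = {g \<in> borel_measurable M. (\<integral>\<^sup>+ x. epowr (g x) p \<partial>M) < \<infinity>}"

definition Lp_loc_nonneg :: "'a::metric_space measure \<Rightarrow> real \<Rightarrow> ('a \<Rightarrow> ennreal) set" where
  "Lp_loc_nonneg M p = {g \<in> borel_measurable M.
     \<forall>x\<in>space M. \<exists>r>0. g \<in> Lp_nonneg (restrict_space M (ball x r)) p}"

definition p_almost_every_curve ::
  "'a::metric_space measure \<Rightarrow> real \<Rightarrow> ((real \<Rightarrow> 'a) \<Rightarrow> real \<Rightarrow> bool) \<Rightarrow> bool" where
  "p_almost_every_curve M p P \<longleftrightarrow>
     (\<exists>\<rho> \<in> Lp_nonneg M p. \<forall>\<gamma> l. arc_length_curve (space M) \<gamma> l \<and> \<not> P \<gamma> l \<longrightarrow>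
        curve_integral \<rho> \<gamma> l = \<infinity>)"

definition abs_difference :: "ereal \<Rightarrow> ereal \<Rightarrow> ennreal" where
  "abs_difference a b = (if \<bar>a\<bar> = \<infinity> \<or> \<bar>b\<bar> = \<infinity> then \<infinity> else e2ennreal \<bar>a - b\<bar>)"

definition p_weak_upper_gradient ::
  "'a::metric_space measure \<Rightarrow> real \<Rightarrow> ('a \<Rightarrow> ereal) \<Rightarrow> ('a \<Rightarrow> ennreal) \<Rightarrow> bool" where
  "p_weak_upper_gradient M p f g \<longleftrightarrow>
     g \<in> borel_measurable M \<and>
     p_almost_every_curve M p
       (\<lambda>\<gamma> l. abs_difference (f (\<gamma> 0)) (f (\<gamma> l)) \<le> curve_integral g \<gamma> l)"

text \<open>
  The minimal \<open>p\<close>-weak upper gradient \<open>g\<^sub>f\<close> is determined only up to almost everywhere equality, so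
  ``\<open>g = g\<^sub>f\<close>'' is a relation between \<open>f\<close> and \<open>g\<close>.
\<close>

definition minimal_p_weak_upper_gradient ::
  "'a::metric_space measure \<Rightarrow> real \<Rightarrow> ('a \<Rightarrow> ereal) \<Rightarrow> ('a \<Rightarrow> ennreal) \<Rightarrow> bool" where
  "minimal_p_weak_upper_gradient M p f g \<longleftrightarrow>
     p_weak_upper_gradient M p f g \<and> g \<in> Lp_loc_nonneg M p \<and>
     (\<forall>g'. p_weak_upper_gradient M p f g' \<and> g' \<in> Lp_loc_nonneg M p \<longrightarrow>
        (AE x in M. g x \<le> g' x))"

text \<open>The \<open>p\<close>-th power of the Newtonian norm; the infimum over the empty set is \<open>\<infinity>\<close>.\<close>

definition N1p_norm_pow :: "'a::metric_space measure \<Rightarrow> real \<Rightarrow> ('a \<Rightarrow> ereal) \<Rightarrow> ennreal" where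
  "N1p_norm_pow M p f =
     (\<integral>\<^sup>+ x. epowr (e2ennreal \<bar>f x\<bar>) p \<partial>M) +
     (INF g \<in> {g. p_weak_upper_gradient M p f g}. \<integral>\<^sup>+ x. epowr (g x) p \<partial>M)"

definition N1p :: "'a::metric_space measure \<Rightarrow> real \<Rightarrow> ('a \<Rightarrow> ereal) set" where
  "N1p M p = {f \<in> borel_measurable M. N1p_norm_pow M p f < \<infinity>}"

definition sobolev_capacity :: "'a::metric_space measure \<Rightarrow> real \<Rightarrow> 'a set \<Rightarrow> ennreal" where
  "sobolev_capacity M p E =
     (INF f \<in> {f \<in> N1p M p. \<forall>x\<in>E. 1 \<le> f x}. N1p_norm_pow M p f)"


subsection \<open>Doubling and the Poincare inequality\<close>

definition doubling_within :: "'a::metric_space measure \<Rightarrow> 'a set \<Rightarrow> bool" where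
  "doubling_within M U \<longleftrightarrow>
     (\<exists>C>0. \<forall>x r. 0 < r \<and> ball x r \<subseteq> U \<longrightarrow>
        emeasure M (ball x (2 * r)) \<le> ennreal C * emeasure M (ball x r))"

definition locally_doubling :: "'a::metric_space measure \<Rightarrow> bool" where
  "locally_doubling M \<longleftrightarrow> (\<forall>x. \<exists>r>0. doubling_within M (ball x r))"

definition integrable_on_set :: "'a measure \<Rightarrow> 'a set \<Rightarrow> ('a \<Rightarrow> ereal) \<Rightarrow> bool" where
  "integrable_on_set M A u \<longleftrightarrow>
     u \<in> borel_measurable (restrict_space M A) \<and>
     (\<integral>\<^sup>+ x. e2ennreal \<bar>u x\<bar> \<partial>restrict_space M A) < \<infinity>"

text \<open>An integrable \<open>u\<close> is finite almost everywhere, so \<open>real_of_ereal\<close> loses nothing here.\<close>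

definition mean_value :: "'a measure \<Rightarrow> 'a set \<Rightarrow> ('a \<Rightarrow> ereal) \<Rightarrow> real" where
  "mean_value M B u = (LINT x|restrict_space M B. real_of_ereal (u x)) / measure M B"

definition poincare_within :: "'a::metric_space measure \<Rightarrow> real \<Rightarrow> 'a set \<Rightarrow> bool" where
  "poincare_within M p U \<longleftrightarrow>
     (\<exists>C>0. \<exists>\<kappa>\<ge>1. \<forall>x r. 0 < r \<and> ball x r \<subseteq> U \<longrightarrow>
        (\<forall>u g. integrable_on_set M (ball x (\<kappa> * r)) u \<and>
               p_weak_upper_gradient (restrict_space M (ball x (\<kappa> * r))) p u g \<longrightarrow>
           (\<integral>\<^sup>+ y. e2ennreal \<bar>u y - ereal (mean_value M (ball x r) u)\<bar>
              \<partial>restrict_space M (ball x r)) / emeasure M (ball x r)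
           \<le> ennreal (C * r) *
             epowr ((\<integral>\<^sup>+ y. epowr (g y) p \<partial>restrict_space M (ball x (\<kappa> * r))) /
                      emeasure M (ball x (\<kappa> * r))) (1 / p)))"

definition local_poincare :: "'a::metric_space measure \<Rightarrow> real \<Rightarrow> bool" where
  "local_poincare M p \<longleftrightarrow> (\<forall>x. \<exists>r>0. poincare_within M p (ball x r))"


subsection \<open>Condenser capacity and parabolicity\<close>

definition admissible ::
  "'a::metric_space measure \<Rightarrow> real \<Rightarrow> 'a set \<Rightarrow> 'a set \<Rightarrow> ('a \<Rightarrow> ereal) \<Rightarrow> bool" where
  "admissible M p E \<Omega> u \<longleftrightarrow>
     u \<in> N1p M p \<and> (\<forall>x\<in>space M. indicator E x \<le> u x \<and> u x \<le> indicator \<Omega> x)"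

text \<open>\<open>has_energy M p \<Omega> u c\<close>: the integral of \<open>g\<^sub>u\<^sup>p\<close> over \<open>\<Omega>\<close> equals \<open>c\<close>.\<close>

definition has_energy ::
  "'a::metric_space measure \<Rightarrow> real \<Rightarrow> 'a set \<Rightarrow> ('a \<Rightarrow> ereal) \<Rightarrow> ennreal \<Rightarrow> bool" where
  "has_energy M p \<Omega> u c \<longleftrightarrow>
     (\<exists>g. minimal_p_weak_upper_gradient M p u g \<and> c = (\<integral>\<^sup>+ x \<in> \<Omega>. epowr (g x) p \<partial>M))"

definition condenser_capacity_bounded ::
  "'a::metric_space measure \<Rightarrow> real \<Rightarrow> 'a set \<Rightarrow> 'a set \<Rightarrow> ennreal" where
  "condenser_capacity_bounded M p E \<Omega> = Inf {c. \<exists>u. admissible M p E \<Omega> u \<and> has_energy M p \<Omega> u c}"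

definition condenser_capacity ::
  "'a::metric_space measure \<Rightarrow> real \<Rightarrow> 'a set \<Rightarrow> 'a set \<Rightarrow> ennreal" where
  "condenser_capacity M p E \<Omega> =
     (if bounded E then condenser_capacity_bounded M p E \<Omega>
      else (THE c. \<forall>x0\<in>space M.
              (\<lambda>j::nat. condenser_capacity_bounded M p (E \<inter> ball x0 (real j)) \<Omega>) \<longlonglongrightarrow> c))"

definition p_parabolic :: "'a::metric_space measure \<Rightarrow> real \<Rightarrow> bool" where
  "p_parabolic M p \<longleftrightarrow>
     \<not> bounded (UNIV :: 'a set) \<and>
     (\<forall>K. compact K \<longrightarrow> condenser_capacity M p K UNIV = 0)"

end

theory Submission
  imports Defs
begin

text \<open>
  By monotonicity and properness, parabolicity kills the capacity of every bounded set, and hence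
  of every set. If \<open>u\<close> is admissible with zero energy, the Poincare inequality makes \<open>u\<close> almost
  everywhere constant near each point; connectedness makes the constant global, and \<open>\<mu>(X) = \<infinity>\<close>
  together with \<open>u \<in> L\<^sup>p\<close> forces it to be \<open>0\<close>. Then \<open>u\<close> has Newtonian norm \<open>0\<close>, so \<open>C\<^sub>p(E) = 0\<close>.
\<close>

lemma epowr_zero [simp]: "epowr 0 q = 0"
  by (simp add: epowr_def)

text \<open>True for every exponent, zero and negative ones included, because
  \<open>0 powr q = 0\<close> by convention and \<infinity> is sent to \<infinity>.\<close>

lemma epowr_eq_0_iff: "epowr a q = 0 \<longleftrightarrow> a = 0"
  by (cases a) (auto simp: epowr_def top_unique)

lemma measurable_epowr [measurable]: "(\<lambda>a. epowr a q) \<in> borel_measurable borel"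
  unfolding epowr_def by measurable

text \<open>A curve in \<open>A\<close> is also a curve in \<open>M\<close>, and the weight
  \<open>\<rho>\<close> of the exceptional family keeps a finite integral on \<open>A\<close>. The
  Poincare inequality asks for gradients on a dilated ball; this supplies them from global
  ones.\<close>

lemma p_weak_upper_gradient_restrict_space:
  assumes "p_weak_upper_gradient M p f g" and A: "A \<in> sets M"
  shows "p_weak_upper_gradient (restrict_space M A) p f g"
proof -
  obtain \<rho> where g: "g \<in> borel_measurable M" and \<rho>: "\<rho> \<in> Lp_nonneg M p"
    and inf: "\<And>\<gamma> l. arc_length_curve (space M) \<gamma> l \<Longrightarrow>
      \<not> abs_difference (f (\<gamma> 0)) (f (\<gamma> l)) \<le> curve_integral g \<gamma> l \<Longrightarrow> curve_integral \<rho> \<gamma> l = \<infinity>"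
    using assms(1) unfolding p_weak_upper_gradient_def p_almost_every_curve_def by blast
  have "(\<integral>\<^sup>+x. epowr (\<rho> x) p \<partial>restrict_space M A) \<le> (\<integral>\<^sup>+x. epowr (\<rho> x) p \<partial>M)"
    using A by (auto simp: nn_integral_restrict_space sets.Int_space_eq2 intro!: nn_integral_mono
        split: split_indicator)
  then have "\<rho> \<in> Lp_nonneg (restrict_space M A) p"
    using \<rho> unfolding Lp_nonneg_def by (auto intro: measurable_restrict_space1)
  moreover have "arc_length_curve (space M) \<gamma> l"
    if "arc_length_curve (space (restrict_space M A)) \<gamma> l" for \<gamma> l
    using that unfolding arc_length_curve_def by (auto simp: space_restrict_space)
  ultimately show ?thesis
    using g inf unfolding p_weak_upper_gradient_def p_almost_every_curve_def
    by (blast intro: measurable_restrict_space1)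
qed

context
  fixes M :: "'a::metric_space measure"
  assumes mms: "metric_measure_space M"
begin

lemma space_eq_UNIV: "space M = UNIV"
  using mms by (simp add: metric_measure_space_def)

lemma ball_in_sets: "ball x r \<in> sets M"
  using mms by (auto simp: metric_measure_space_def)

lemma emeasure_ball_pos: "0 < r \<Longrightarrow> 0 < emeasure M (ball x r)"
  and emeasure_ball_finite: "0 < r \<Longrightarrow> emeasure M (ball x r) < \<infinity>"
  using mms by (auto simp: metric_measure_space_def)

lemma integrable_on_ball:
  assumes "u \<in> borel_measurable M" and "\<And>x. 0 \<le> u x" and "\<And>x. u x \<le> 1" and "0 < r"
  shows "integrable_on_set M (ball x r) u"
proof -
  have "e2ennreal \<bar>u y\<bar> \<le> 1" for y
    using assms(2,3)[of y] by (metis abs_ereal_ge0 e2ennreal_mono e2ennreal_ereal one_ereal_def ennreal_1)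
  then have "(\<integral>\<^sup>+y. e2ennreal \<bar>u y\<bar> \<partial>restrict_space M (ball x r))
      \<le> (\<integral>\<^sup>+y. 1 \<partial>restrict_space M (ball x r))"
    by (intro nn_integral_mono) auto
  also have "\<dots> = emeasure M (ball x r)"
    by (simp add: emeasure_restrict_space space_restrict_space space_eq_UNIV ball_in_sets)
  finally show ?thesis
    using emeasure_ball_finite[OF \<open>0 < r\<close>, of x] assms(1)
    unfolding integrable_on_set_def by (auto intro: measurable_restrict_space1)
qed

text \<open>With \<open>g = 0\<close> a.e. the right-hand side of the Poincare inequality vanishes,
  so \<open>u\<close> has no mean oscillation on the ball and equals its mean value there.\<close>

lemma local_poincare_imp_locally_AE_const:
  assumes "local_poincare M p"
    and u: "u \<in> borel_measurable M" "\<And>x. 0 \<le> u x" "\<And>x. u x \<le> 1"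
    and g: "p_weak_upper_gradient M p u g" "AE x in M. g x = 0"
  shows "\<exists>r>0. \<exists>c::real. AE y in M. y \<in> ball x r \<longrightarrow> u y = ereal c"
proof -
  obtain r where "r > 0" and "poincare_within M p (ball x r)"
    using assms(1) unfolding local_poincare_def by blast
  \<comment> \<open>One instance suffices: the ball that is the whole neighbourhood. Its dilate may
    leave the neighbourhood, which is harmless since \<open>g\<close> vanishes a.e. on all of
    \<open>M\<close>.\<close>
  then obtain C \<kappa> where "\<kappa> \<ge> 1" and P: "\<And>v h. integrable_on_set M (ball x (\<kappa> * r)) v \<Longrightarrow>
      p_weak_upper_gradient (restrict_space M (ball x (\<kappa> * r))) p v h \<Longrightarrow>
      (\<integral>\<^sup>+ y. e2ennreal \<bar>v y - ereal (mean_value M (ball x r) v)\<bar> \<partial>restrict_space M (ball x r))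
        / emeasure M (ball x r)
      \<le> ennreal (C * r) * epowr ((\<integral>\<^sup>+ y. epowr (h y) p \<partial>restrict_space M (ball x (\<kappa> * r))) /
                      emeasure M (ball x (\<kappa> * r))) (1 / p)"
    unfolding poincare_within_def by blast
  define c where "c = mean_value M (ball x r) u"
  let ?B = "restrict_space M (ball x r)"
  have "(\<integral>\<^sup>+ y. epowr (g y) p \<partial>restrict_space M (ball x (\<kappa> * r))) = (\<integral>\<^sup>+ y. 0 \<partial>restrict_space M (ball x (\<kappa> * r)))"
    using g(2) by (intro nn_integral_cong_AE)
      (auto simp: AE_restrict_space_iff ball_in_sets sets.Int_space_eq2)
  then have "(\<integral>\<^sup>+ y. e2ennreal \<bar>u y - ereal c\<bar> \<partial>?B) / emeasure M (ball x r) = 0"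
    using P[OF integrable_on_ball[OF u] p_weak_upper_gradient_restrict_space[OF g(1) ball_in_sets]]
      \<open>r > 0\<close> \<open>\<kappa> \<ge> 1\<close> by (simp add: c_def)
  \<comment> \<open>An \<open>ennreal\<close> quotient is also 0 when the denominator is
    \<infinity>; finite measure of the ball excludes this.\<close>
  then have "(\<integral>\<^sup>+ y. e2ennreal \<bar>u y - ereal c\<bar> \<partial>?B) = 0"
    using emeasure_ball_finite[OF \<open>r > 0\<close>, of x]
    by (auto simp: ennreal_divide_eq_0_iff)
  moreover have [measurable]: "u \<in> borel_measurable ?B"
    using u(1) by (rule measurable_restrict_space1)
  ultimately have "AE y in ?B. e2ennreal \<bar>u y - ereal c\<bar> = 0"
    by (subst (asm) nn_integral_0_iff_AE) auto
  \<comment> \<open>An infinite \<open>v\<close> would give \<infinity>, and the absolute value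
    keeps \<open>e2ennreal\<close> from truncating a negative number to 0.\<close>
  moreover have "v = ereal c" if "e2ennreal \<bar>v - ereal c\<bar> = 0" for v
    using that by (cases v) (auto simp: e2ennreal_infty)
  ultimately have "AE y in ?B. u y = ereal c"
    by (auto elim: eventually_mono)
  then show ?thesis
    using \<open>r > 0\<close> by (auto simp: AE_restrict_space_iff ball_in_sets)
qed

text \<open>The overlap of the two balls contains a ball around \<open>y\<close>, which has positive
  measure, so both a.e. equalities hold at a common point.\<close>

lemma AE_const_on_balls_unique:
  fixes c d :: real
  assumes "AE z in M. z \<in> ball x r \<longrightarrow> u z = ereal c" and "AE z in M. z \<in> ball y s \<longrightarrow> u z = ereal d"
    and "y \<in> ball x r" and "0 < s"
  shows "c = d"
proof (rule ccontr)
  assume "c \<noteq> d"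
  obtain t where "t > 0" and t: "ball y t \<subseteq> ball x r \<inter> ball y s"
    using assms(3,4) openE[of "ball x r \<inter> ball y s" y] by (metis Int_iff centre_in_ball open_Int open_ball)
  have "AE z in M. z \<notin> ball y t"
    using assms(1,2) by eventually_elim (use t \<open>c \<noteq> d\<close> in auto)
  then have "emeasure M (ball y t) = 0"
    by (subst (asm) AE_iff_null_sets[symmetric]) (auto simp: ball_in_sets)
  with emeasure_ball_pos[OF \<open>t > 0\<close>, of y] show False
    by simp
qed

text \<open>Uncountably many null sets cannot be united directly. Compactness of closed balls leaves
  finitely many exceptional sets per ball, and countably many closed balls exhaust the
  space.\<close>

lemma proper_space_AE_local_imp_AE:
  assumes "proper_space TYPE('a)" and loc: "\<And>x. \<exists>r>0. AE y in M. y \<in> ball x r \<longrightarrow> Q y"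
  shows "AE y in M. Q y"
proof -
  obtain r where r: "\<And>x. r x > 0" "\<And>x. AE y in M. y \<in> ball x (r x) \<longrightarrow> Q y"
    using loc by metis
  have "AE y in M. y \<in> cball a (real n) \<longrightarrow> Q y" for a n
  proof -
    have "compact (cball a (real n))"
      using assms(1) by (simp add: proper_space_def)
    moreover have "cball a (real n) \<subseteq> (\<Union>x\<in>UNIV. ball x (r x))"
      using r(1) centre_in_ball by blast
    ultimately obtain F where "finite F" and F: "cball a (real n) \<subseteq> (\<Union>x\<in>F. ball x (r x))"
      using compactE_image[of "cball a (real n)" UNIV "\<lambda>x. ball x (r x)"] by auto
    have "AE y in M. \<forall>x\<in>F. y \<in> ball x (r x) \<longrightarrow> Q y"
      using r(2) by (subst AE_finite_all[OF \<open>finite F\<close>]) blast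
    then show ?thesis
      by eventually_elim (use F in blast)
  qed
  then have "AE y in M. \<forall>n. y \<in> cball a (real n) \<longrightarrow> Q y" for a
    by (subst AE_all_countable) blast
  then show ?thesis
    by eventually_elim (auto simp: real_arch_simple)
qed

lemma zero_gradient_imp_AE_const:
  assumes "local_poincare M p" and "proper_space TYPE('a)" and "connected (UNIV :: 'a set)"
    and u: "u \<in> borel_measurable M" "\<And>x. 0 \<le> u x" "\<And>x. u x \<le> 1"
    and g: "p_weak_upper_gradient M p u g" "AE x in M. g x = 0"
  shows "\<exists>c::real. AE y in M. u y = ereal c"
proof -
  obtain r c where r: "\<And>x. r x > 0" and c: "\<And>x. AE y in M. y \<in> ball x (r x) \<longrightarrow> u y = ereal (c x)"
    using local_poincare_imp_locally_AE_const[OF assms(1) u g] by metis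
  \<comment> \<open>The map \<open>c\<close> is locally constant: if \<open>y\<close> lies in
    \<open>ball x (r x)\<close>, the balls chosen at \<open>x\<close> and \<open>y\<close> overlap
    around \<open>y\<close>.\<close>
  have "\<forall>\<^sub>F y in at x. c x = c y" for x
    unfolding eventually_at
    by (rule exI[of _ "r x"])
      (auto intro!: AE_const_on_balls_unique[OF c c _ r] r simp: dist_commute)
  then have "c x = c y" for x y
    using connected_local_const[OF assms(3), of x y c] by auto
  \<comment> \<open>All values of \<open>c\<close> agree, so \<open>undefined\<close> merely serves
    as an arbitrary base point.\<close>
  then have "AE y in M. y \<in> ball x (r x) \<longrightarrow> u y = ereal (c undefined)" for x
    using c[of x] by metis
  then show ?thesis
    using r by (intro exI proper_space_AE_local_imp_AE[OF assms(2)]) blast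
qed

text \<open>The function \<open>u\<close> is itself a competitor for the Sobolev capacity: it is at
  least 1 at every point of \<open>E\<close>, although it turns out to be 0 a.e.\<close>

lemma zero_energy_imp_sobolev_capacity_eq_0:
  assumes "local_poincare M p" and "proper_space TYPE('a)" and "connected (UNIV :: 'a set)"
    and "emeasure M UNIV = \<infinity>"
    and adm: "admissible M p E UNIV u" and "has_energy M p UNIV u 0"
  shows "sobolev_capacity M p E = 0"
proof -
  obtain g where g: "p_weak_upper_gradient M p u g" and g0: "(\<integral>\<^sup>+x. epowr (g x) p \<partial>M) = 0"
    using assms(6) by (auto simp: has_energy_def minimal_p_weak_upper_gradient_def)
  have [measurable]: "g \<in> borel_measurable M"
    using g by (simp add: p_weak_upper_gradient_def)
  have "AE x in M. g x = 0"
    using g0 by (subst (asm) nn_integral_0_iff_AE) (auto simp: epowr_eq_0_iff)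
  have u: "u \<in> N1p M p" "\<And>x. indicator E x \<le> u x" "\<And>x. u x \<le> 1"
    using adm by (auto simp: admissible_def space_eq_UNIV)
  have u0: "0 \<le> u x" for x
    using u(2)[of x] by (rule order_trans[rotated]) (simp add: indicator_def)
  have um: "u \<in> borel_measurable M" and norm: "N1p_norm_pow M p u < \<infinity>"
    using u(1) by (auto simp: N1p_def)
  obtain c :: real where c: "AE y in M. u y = ereal c"
    using zero_gradient_imp_AE_const[OF assms(1-3) um u0 u(3) g \<open>AE x in M. g x = 0\<close>] by blast
  have "(\<integral>\<^sup>+x. epowr (e2ennreal \<bar>u x\<bar>) p \<partial>M) = (\<integral>\<^sup>+x. epowr (e2ennreal \<bar>ereal c\<bar>) p \<partial>M)"
    using c by (intro nn_integral_cong_AE) (auto elim: eventually_mono)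
  also have "\<dots> = epowr (ennreal \<bar>c\<bar>) p * \<infinity>"
    using assms(4) by (simp add: space_eq_UNIV)
  finally have Lp: "(\<integral>\<^sup>+x. epowr (e2ennreal \<bar>u x\<bar>) p \<partial>M) = epowr (ennreal \<bar>c\<bar>) p * \<infinity>" .
  with norm have "epowr (ennreal \<bar>c\<bar>) p * \<infinity> < \<infinity>"
    by (auto simp: N1p_norm_pow_def less_top)
  \<comment> \<open>In \<open>ennreal\<close>, \<open>0 * \<infinity> = 0\<close>, while any nonzero
    factor would make the product infinite.\<close>
  then have "epowr (ennreal \<bar>c\<bar>) p = 0"
    by (auto simp: ennreal_mult_top split: if_splits)
  with Lp have "(\<integral>\<^sup>+x. epowr (e2ennreal \<bar>u x\<bar>) p \<partial>M) = 0"
    by simp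
  moreover have "(INF h \<in> {h. p_weak_upper_gradient M p u h}. \<integral>\<^sup>+x. epowr (h x) p \<partial>M) \<le> 0"
    using g by (intro INF_lower2[of g]) (auto simp: g0)
  ultimately have "N1p_norm_pow M p u \<le> 0"
    by (simp add: N1p_norm_pow_def)
  moreover have "1 \<le> u x" if "x \<in> E" for x
    using u(2)[of x] that by simp
  then have "sobolev_capacity M p E \<le> N1p_norm_pow M p u"
    unfolding sobolev_capacity_def using u(1) by (intro INF_lower) simp
  ultimately show ?thesis
    by simp
qed

text \<open>Every function admissible for \<open>F\<close> is admissible for \<open>E\<close>, so
  the infimum for \<open>E\<close> runs over a larger set of energies.\<close>

lemma condenser_capacity_bounded_mono:
  assumes "E \<subseteq> F"
  shows "condenser_capacity_bounded M p E \<Omega> \<le> condenser_capacity_bounded M p F \<Omega>"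
proof -
  have "admissible M p E \<Omega> u" if "admissible M p F \<Omega> u" for u
  proof -
    have "(indicator E x :: ereal) \<le> indicator F x" for x
      using assms by (auto simp: indicator_def)
    then show ?thesis
      using that unfolding admissible_def by (meson order_trans)
  qed
  then show ?thesis
    unfolding condenser_capacity_bounded_def by (intro Inf_superset_mono) blast
qed

lemma p_parabolic_imp_condenser_capacity_eq_0:
  assumes "proper_space TYPE('a)" and "p_parabolic M p"
  shows "condenser_capacity M p E UNIV = 0"
proof -
  have bdd: "condenser_capacity_bounded M p F UNIV = 0" if "bounded F" for F
  proof -
    have "compact (closure F)"
      using assms(1) that by (simp add: proper_space_def bounded_closure)
    \<comment> \<open>The closure is bounded, so its capacity is given by the bounded case of the
      definition.\<close>
    then have "condenser_capacity_bounded M p (closure F) UNIV = 0"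
      using assms(2) bounded_closure[OF that]
      by (auto simp: p_parabolic_def condenser_capacity_def dest: spec[of _ "closure F"])
    then show ?thesis
      using condenser_capacity_bounded_mono[OF closure_subset, of p F UNIV] by simp
  qed
  \<comment> \<open>For unbounded \<open>E\<close> every truncation is bounded and has capacity 0.
    The description then picks the limit of the zero sequence, which is unique because
    \<open>space M\<close> is nonempty.\<close>
  have "(THE c. \<forall>x0::'a\<in>space M. (\<lambda>j::nat. 0::ennreal) \<longlonglongrightarrow> c) = 0"
    by (rule the_equality) (auto simp: space_eq_UNIV LIMSEQ_const_iff)
  then show ?thesis
    by (simp add: condenser_capacity_def bdd bounded_Int)
qed

end

theorem proposition6p1:
  fixes M :: "'a::metric_space measure" and p :: real
  assumes "1 < p"
    and "metric_measure_space M"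
    and "proper_space TYPE('a)"
    and "connected (UNIV :: 'a set)"
    and "locally_doubling M"
    and "local_poincare M p"
    and "p_parabolic M p"
    and "emeasure M UNIV = \<infinity>"
  shows "(\<forall>E :: 'a set. condenser_capacity M p E UNIV = 0) \<and>
         (\<forall>E :: 'a set. sobolev_capacity M p E > 0 \<longrightarrow>
            \<not> (\<exists>u. admissible M p E UNIV u \<and> has_energy M p UNIV u 0) \<and>
            \<not> (\<exists>u. admissible M p E UNIV u \<and>
                   has_energy M p UNIV u (condenser_capacity M p E UNIV)))"
  \<comment> \<open>As the capacity is 0, attaining it means having energy 0, so both nonexistence
    claims follow from the same contradiction with positive Sobolev capacity.\<close>
  using p_parabolic_imp_condenser_capacity_eq_0[OF assms(2,3,7)]
    zero_energy_imp_sobolev_capacity_eq_0[OF assms(2,6,3,4,8)]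
  by (metis less_irrefl)

end
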